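(* Let $k \ge 3$ and $m \ge 2$ be integers, and let $X$ be the $k^{\text{th}}$ cartesian power of a directed cycle of length $m$. For vertices $u$ and $v$ of $X$, there is a hamiltonian path from $u$ to $v$ in $X$ if and only if $$d_X(u,v) \equiv -1 \pmod{m}.$$
   Context: The cartesian product $G_1 \times G_2$ of two digraphs is the digraph with vertex set $V(G_1) \times V(G_2)$ and an arc from $(u_1,u_2)$ to $(v_1,v_2)$ if and only if either $u_1 = v_1$ and there is an arc from $u_2$ to $v_2$ in $G_2$, or $u_2 = v_2$ and there is an arc from $u_1$ to $v_1$ in $G_1$. The $k^{\text{th}}$ cartesian power of a digraph $G$ is the cartesian product of $k$ copies of $G$. The directed cycle of length $m \ge 2$ has vertex set $\mathbb{Z}_m$ and an arc from $i$ to $i+1$ for each $i \in \mathbb{Z}_m$ (for $m=2$ this is the digraph with two vertices and an arc in each direction). For vertices $u,v$ of a strongly connected digraph $X$, $d_X(u,v)$ denotes the length (number of arcs) of the shortest directed path from $u$ to $v$. All paths are directed; a hamiltonian path from $u$ to $v$ is a directed path starting at $u$, ending at $v$, and visiting every vertex exactly once. *)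

theory Defs
  imports "Graph_Theory.Graph_Theory" "HOL-Number_Theory.Cong"
begin

(* The integers modulo m are represented by 0, ..., m - 1. *)
definition directed_cycle :: "nat \<Rightarrow> nat pair_pre_digraph" where
  "directed_cycle m =
    \<lparr> pverts = {0..<m}, parcs = {(i, (i + 1) mod m) | i. i \<in> {0..<m}} \<rparr>"

definition cartesian_product ::
    "'a pair_pre_digraph \<Rightarrow> 'b pair_pre_digraph \<Rightarrow> ('a \<times> 'b) pair_pre_digraph" where
  "cartesian_product G H =
    \<lparr> pverts = pverts G \<times> pverts H,
      parcs = {((u1, u2), (v1, v2)) | u1 u2 v1 v2.
        (u1 \<in> pverts G \<and> u1 = v1 \<and> (u2, v2) \<in> parcs H) \<or>
        (u2 \<in> pverts H \<and> u2 = v2 \<and> (u1, v1) \<in> parcs G)} \<rparr>"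

definition rename_verts :: "('a \<Rightarrow> 'b) \<Rightarrow> 'a pair_pre_digraph \<Rightarrow> 'b pair_pre_digraph" where
  "rename_verts f G = \<lparr> pverts = f ` pverts G, parcs = map_prod f f ` parcs G \<rparr>"

(* The iterated product would change its type with k; the pair (x, xs) is therefore
   renamed injectively to the list x # xs, so that the vertices of the k-th power are
   lists of length k. The 0-th power is the neutral element of the product. *)
primrec cartesian_power :: "nat \<Rightarrow> 'a pair_pre_digraph \<Rightarrow> 'a list pair_pre_digraph" where
  "cartesian_power 0 G = \<lparr> pverts = {[]}, parcs = {} \<rparr>"
| "cartesian_power (Suc k) G =
    rename_verts (\<lambda>(x, xs). x # xs) (cartesian_product G (cartesian_power k G))"

lemma pverts_cartesian_power:
  "pverts (cartesian_power k G) = {xs. length xs = k \<and> set xs \<subseteq> pverts G}"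
  by (induction k)
    (auto simp: rename_verts_def cartesian_product_def length_Suc_conv image_iff)

lemma parcs_cartesian_power:
  assumes "pair_wf_digraph G"
  shows "(xs, ys) \<in> parcs (cartesian_power k G) \<longleftrightarrow>
    length xs = k \<and> set xs \<subseteq> pverts G \<and>
    (\<exists>i<k. \<exists>y. (xs ! i, y) \<in> parcs G \<and> ys = xs[i := y])"
proof (induction k arbitrary: xs ys)
  case 0
  then show ?case by simp
next
  case (Suc k)
  have wf: "x \<in> pverts G" if "(x, y) \<in> parcs G" for x y
    using pair_wf_digraph.in_arcsD1[OF assms that] .
  have "(xs, ys) \<in> parcs (cartesian_power (Suc k) G) \<longleftrightarrow>
      (\<exists>x us y vs. xs = x # us \<and> ys = y # vs \<and>
        ((x \<in> pverts G \<and> x = y \<and> (us, vs) \<in> parcs (cartesian_power k G)) \<or>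
         (us \<in> pverts (cartesian_power k G) \<and> us = vs \<and> (x, y) \<in> parcs G)))"
    by (fastforce simp: rename_verts_def cartesian_product_def image_iff)
  also have "\<dots> \<longleftrightarrow> length xs = Suc k \<and> set xs \<subseteq> pverts G \<and>
      (\<exists>i<Suc k. \<exists>y. (xs ! i, y) \<in> parcs G \<and> ys = xs[i := y])"
    by (cases xs)
      (auto simp: Suc.IH pverts_cartesian_power Ex_less_Suc2 dest: wf)
  finally show ?case .
qed

(* Only meaningful if v is reachable from u. *)
definition digraph_dist :: "('a, 'b) pre_digraph \<Rightarrow> 'a \<Rightarrow> 'a \<Rightarrow> nat" where
  "digraph_dist G u v =
    (LEAST n. \<exists>p. vpath p G \<and> hd p = u \<and> last p = v \<and> vwalk_length p = n)"

definition hamiltonian_path :: "('a, 'b) pre_digraph \<Rightarrow> 'a \<Rightarrow> 'a list \<Rightarrow> 'a \<Rightarrow> bool" where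
  "hamiltonian_path G u p v \<longleftrightarrow>
    vpath p G \<and> hd p = u \<and> last p = v \<and> set p = verts G"

end

theory Submission
  imports Defs
begin

text \<open>
  Each arc raises the coordinate sum by 1 modulo m. So a path of length n from u to v forces
  n to be congruent to the difference of the coordinate sums, and a hamiltonian path, having
  length m^k - 1, forces this difference to be -1.

  Conversely, split off one coordinate c. The other coordinates form a torus with a hamiltonian
  cycle of length N = m^(k-1), so X contains the product of directed cycles of lengths N and m.
  In this two-dimensional torus there is an explicit hamiltonian path from (0, 0) to (z, -1 - z)
  for every even z < N. It remains to choose c and the cycle such that the projection of v
  lies at an even position z, counted from the projection of u.
  If m is even, the parity of z is that of the difference of the coordinate sums, and some
  coordinate c changes parity between u and v, since the total changes by an odd amount.
  If m is odd, one uses that two different starting points on the same cycle give distances of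
  different parity between translates of the same pair, which works as soon as there are
  at least two coordinates besides c.
\<close>

section \<open>Hamiltonian cycles of tori\<close>

text \<open>Vertices are extensional functions on an arbitrary index set, so that a coordinate
  \<open>c\<close> can be split off as \<open>u(c := undefined)\<close> without renumbering the
  others.\<close>

definition torus :: "nat \<Rightarrow> 'a set \<Rightarrow> ('a \<Rightarrow> nat) set" where
  "torus m S = PiE S (\<lambda>_. {..<m})"

definition step :: "nat \<Rightarrow> 'a set \<Rightarrow> ('a \<Rightarrow> nat) \<Rightarrow> ('a \<Rightarrow> nat) \<Rightarrow> bool" where
  "step m S g h \<longleftrightarrow> (\<exists>c\<in>S. h = g(c := Suc (g c) mod m))"

text \<open>The cycle is unrolled to an infinite sequence: the last equivalence gives both its
  period and injectivity within a period, and positions beyond one turn keep a meaning. That every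
  vertex occurs follows by counting.\<close>

definition ham_cycle :: "nat \<Rightarrow> 'a set \<Rightarrow> (nat \<Rightarrow> 'a \<Rightarrow> nat) \<Rightarrow> bool" where
  "ham_cycle m S f \<longleftrightarrow> (\<forall>i. f i \<in> torus m S) \<and> (\<forall>i. step m S (f i) (f (Suc i))) \<and>
    (\<forall>i j. f i = f j \<longleftrightarrow> [i = j] (mod m ^ card S))"

definition ham_path :: "nat \<Rightarrow> 'a set \<Rightarrow> (nat \<Rightarrow> 'a \<Rightarrow> nat) \<Rightarrow> bool" where
  "ham_path m S p \<longleftrightarrow> (\<forall>i<m ^ card S. p i \<in> torus m S) \<and>
    (\<forall>i. Suc i < m ^ card S \<longrightarrow> step m S (p i) (p (Suc i))) \<and> inj_on p {..<m ^ card S}"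

lemma card_torus: "finite S \<Longrightarrow> card (torus m S) = m ^ card S"
  by (simp add: torus_def card_PiE)

lemma finite_torus: "finite S \<Longrightarrow> finite (torus m S)"
  by (simp add: torus_def finite_PiE)

lemma torus_upd: "g \<in> torus m S \<Longrightarrow> y < m \<Longrightarrow> g(c := y) \<in> torus m (insert c S)"
  unfolding torus_def by (rule PiE_fun_upd) auto

lemma torus_del: "u \<in> torus m (insert c S) \<Longrightarrow> c \<notin> S \<Longrightarrow> u(c := undefined) \<in> torus m S"
  unfolding torus_def by (rule fun_upd_in_PiE)

lemma torus_upd_eq_iff:
  assumes "g \<in> torus m S" "h \<in> torus m S" "c \<notin> S"
  shows "g(c := x) = h(c := y) \<longleftrightarrow> g = h \<and> x = y"
  using assms unfolding torus_def
  by (metis PiE_arb fun_upd_same fun_upd_triv fun_upd_upd)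

lemma torus_less: "g \<in> torus m S \<Longrightarrow> c \<in> S \<Longrightarrow> g c < m"
  by (auto simp: torus_def)

lemma step_upd_other:
  assumes "step m S g h" "c \<notin> S"
  shows "step m (insert c S) (g(c := x)) (h(c := x))"
  using assms unfolding step_def by (metis (no_types, lifting) fun_upd_other fun_upd_twist insertCI)

lemma step_upd_same:
  "y = Suc x mod m \<Longrightarrow> step m (insert c S) (g(c := x)) (g(c := y))"
  unfolding step_def by auto

section \<open>Coordinate sums along walks\<close>

lemma sum_step:
  assumes "step m S g h" "finite S"
  shows "[sum h S = Suc (sum g S)] (mod m)"
proof -
  obtain c where c: "c \<in> S" "h = g(c := Suc (g c) mod m)"
    using assms(1) by (auto simp: step_def)
  have "sum h S = Suc (g c) mod m + sum g (S - {c})"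
    using c assms(2) by (simp add: sum.remove)
  moreover have "Suc (sum g S) = Suc (g c) + sum g (S - {c})"
    using c assms(2) by (simp add: sum.remove)
  ultimately show ?thesis by (simp add: cong_def mod_simps)
qed

lemma sum_walk:
  assumes "\<And>i. i < n \<Longrightarrow> step m S (f i) (f (Suc i))" "finite S"
  shows "[sum (f n) S = sum (f 0) S + n] (mod m)"
  using assms(1)
proof (induction n)
  case (Suc n)
  then have "[sum (f n) S = sum (f 0) S + n] (mod m)" by auto
  then have "[Suc (sum (f n) S) = Suc (sum (f 0) S + n)] (mod m)"
    using cong_add_rcancel_nat[of _ 1] by simp
  then show ?case using sum_step[OF Suc.prems[of n] assms(2)] cong_trans by fastforce
qed simp

lemma ham_cycle_surj:
  assumes "ham_cycle m S f" "finite S" "v \<in> torus m S"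
  obtains z where "z < m ^ card S" "f z = v"
proof -
  have "inj_on f {..<m ^ card S}"
    using assms(1) by (auto simp: ham_cycle_def inj_on_def cong_def)
  then have "card (f ` {..<m ^ card S}) = m ^ card S" by (simp add: card_image)
  then have "f ` {..<m ^ card S} = torus m S"
    using assms by (intro card_subset_eq) (auto simp: card_torus finite_torus ham_cycle_def)
  then have "v \<in> f ` {..<m ^ card S}" using assms(3) by simp
  then show thesis by (elim imageE) (use that in simp)
qed

lemma ham_cycle_singleton:
  assumes "u \<in> torus m {c}" "m \<ge> 2"
  shows "ham_cycle m {c} (\<lambda>i. u(c := (u c + i) mod m))"
    and "u(c := (u c + 0) mod m) = u"
proof -
  have "u c < m" using assms by (simp add: torus_less)
  then show "u(c := (u c + 0) mod m) = u" by auto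
  have "u(c := (u c + i) mod m) \<in> torus m {c}" for i
    using torus_upd[OF assms(1), of _ c] assms(2) by simp
  moreover have "step m {c} (u(c := (u c + i) mod m)) (u(c := (u c + Suc i) mod m))" for i
    by (rule step_upd_same) (simp add: mod_Suc_eq)
  moreover have "u(c := (u c + i) mod m) = u(c := (u c + j) mod m) \<longleftrightarrow> [i = j] (mod m)" for i j
    by (metis cong_add_lcancel_nat cong_def fun_upd_same)
  ultimately show "ham_cycle m {c} (\<lambda>i. u(c := (u c + i) mod m))"
    by (simp add: ham_cycle_def)
qed

lemma cong_modulus_power: "[i = j] (mod m ^ n) \<Longrightarrow> n > 0 \<Longrightarrow> [i = j] (mod m)" for m :: nat
  by (meson cong_dvd_modulus_nat dvd_power)

text \<open>
  A path that follows \<open>f\<close> whenever \<open>e\<close> increases and otherwise increments coordinate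
  \<open>c\<close>; adding \<open>(m - 1) * e i\<close> amounts to subtracting \<open>e i\<close> modulo \<open>m\<close>.
\<close>

definition staircase ::
    "nat \<Rightarrow> 'a \<Rightarrow> nat \<Rightarrow> (nat \<Rightarrow> 'a \<Rightarrow> nat) \<Rightarrow> (nat \<Rightarrow> nat) \<Rightarrow> nat \<Rightarrow> 'a \<Rightarrow> nat" where
  "staircase m c b f e i = (f (e i))(c := (b + i + (m - 1) * e i) mod m)"

lemma staircase_in_torus:
  assumes "ham_cycle m S f" "m \<ge> 2"
  shows "staircase m c b f e i \<in> torus m (insert c S)"
  using assms torus_upd[of "f (e i)" m S] by (simp add: ham_cycle_def staircase_def)

text \<open>When \<open>e\<close> increases, \<open>i + (m - 1) * e i\<close> grows by exactly
  \<open>m\<close>, so coordinate \<open>c\<close> stays fixed and only \<open>f\<close> moves; when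
  \<open>e\<close> rests, coordinate \<open>c\<close> grows by 1.\<close>

lemma step_staircase:
  assumes f: "ham_cycle m S f" and "c \<notin> S" and m: "m \<ge> 2"
    and e: "e (Suc i) = e i \<or> e (Suc i) = Suc (e i)"
  shows "step m (insert c S) (staircase m c b f e i) (staircase m c b f e (Suc i))"
  using e
proof
  assume e: "e (Suc i) = Suc (e i)"
  have "b + Suc i + (m - 1) * e (Suc i) = b + i + (m - 1) * e i + m"
    using m e by (cases m) simp_all
  then have "(b + Suc i + (m - 1) * e (Suc i)) mod m = (b + i + (m - 1) * e i) mod m"
    by (metis mod_add_self2)
  then show ?thesis
    using step_upd_other[of m S "f (e i)" "f (e (Suc i))"] f assms(2) e
    by (simp add: ham_cycle_def staircase_def)
next
  assume "e (Suc i) = e i"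
  then show ?thesis
    unfolding staircase_def by (simp, intro step_upd_same) (simp add: mod_Suc_eq)
qed

text \<open>As \<open>S\<close> is nonempty, \<open>m\<close> divides \<open>m ^ card S\<close>.
  Equal positions on \<open>f\<close> therefore contribute equally to coordinate \<open>c\<close>,
  which leaves only the comparison of \<open>i\<close> and \<open>j\<close>.\<close>

lemma staircase_eq_iff:
  assumes f: "ham_cycle m S f" and S: "finite S" "S \<noteq> {}" "c \<notin> S" and m: "m \<ge> 2"
  shows "staircase m c b f e i = staircase m c b f e j \<longleftrightarrow>
    [e i = e j] (mod m ^ card S) \<and> [i = j] (mod m)"
proof -
  define y where "y i = b + i + (m - 1) * e i" for i
  have "f i \<in> torus m S" for i using f by (simp add: ham_cycle_def)
  then have eq: "staircase m c b f e i = staircase m c b f e j \<longleftrightarrow>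
      [e i = e j] (mod m ^ card S) \<and> [y i = y j] (mod m)"
    using f S(3) torus_upd_eq_iff[of "f (e i)" m S "f (e j)" c]
    by (simp add: staircase_def ham_cycle_def y_def cong_def)
  have "[y i = y j] (mod m) \<longleftrightarrow> [i = j] (mod m)" if "[e i = e j] (mod m ^ card S)"
  proof -
    have "[e i = e j] (mod m)"
      using that S by (intro cong_modulus_power[of _ _ m "card S"]) (auto simp: card_gt_0_iff)
    then have "[y i = b + i + (m - 1) * e j] (mod m)"
      unfolding y_def by (intro cong_add cong_mult) auto
    then have "[y i = y j] (mod m) \<longleftrightarrow> [b + i + (m - 1) * e j = y j] (mod m)"
      by (simp add: cong_def)
    then show ?thesis
      unfolding y_def by (simp add: cong_add_rcancel_nat cong_add_lcancel_nat)
  qed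
  then show ?thesis using eq by blast
qed

text \<open>While \<open>i + r\<close> runs through a block of \<open>m\<close> values, coordinate
  \<open>c\<close> takes all its values; then \<open>f\<close> advances once. The offset
  \<open>r\<close> sets where within its row the cycle starts.\<close>

lemma ham_cycle_insert:
  assumes f: "ham_cycle m S f" and S: "finite S" "S \<noteq> {}" "c \<notin> S" and m: "m \<ge> 2"
  shows "ham_cycle m (insert c S) (staircase m c b f (\<lambda>i. (i + r) div m))"
proof -
  define N where "N = m ^ card S"
  define q where "q = (\<lambda>i. (i + r) div m)"
  have card: "m ^ card (insert c S) = m * N" using S by (simp add: N_def)
  have "q (Suc i) = q i \<or> q (Suc i) = Suc (q i)" for i
    by (simp add: q_def div_Suc)
  then have "step m (insert c S) (staircase m c b f q i) (staircase m c b f q (Suc i))" for i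
    using step_staircase[OF f S(3) m] by blast
  moreover have "[q i = q j] (mod N) \<and> [i = j] (mod m) \<longleftrightarrow> [i = j] (mod m * N)" for i j
  proof -
    \<comment> \<open>Mixed radix: the digits of \<open>i + r\<close> modulo \<open>m * N\<close>
      are \<open>q i mod N\<close> and \<open>(i + r) mod m\<close>.\<close>
    have "(i + r) mod (m * N) = m * (q i mod N) + (i + r) mod m" for i
      by (simp add: mod_mult2_eq q_def)
    moreover have "m * x + (i + r) mod m = m * x' + (j + r) mod m \<longleftrightarrow>
        x = x' \<and> (i + r) mod m = (j + r) mod m" for x x'
      using m by (metis add_left_cancel div_mult_self4 mod_div_trivial mod_mod_trivial
        mod_mult_self4 mult_is_0 not_numeral_le_zero add_0_right)
    ultimately have "[i + r = j + r] (mod m * N) \<longleftrightarrow> [q i = q j] (mod N) \<and> [i + r = j + r] (mod m)"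
      by (simp add: cong_def)
    then show ?thesis by (auto simp: cong_add_rcancel_nat)
  qed
  ultimately have "ham_cycle m (insert c S) (staircase m c b f q)"
    unfolding ham_cycle_def card staircase_eq_iff[OF f S m] N_def[symmetric]
    using staircase_in_torus[OF f m] by blast
  then show ?thesis by (simp add: q_def)
qed

lemma ham_cycle_exists:
  assumes "finite S" "S \<noteq> {}" "u \<in> torus m S" "m \<ge> 2"
  obtains f where "ham_cycle m S f" "f 0 = u"
proof -
  have "\<exists>f. ham_cycle m S f \<and> f 0 = u" using assms(1-3)
  proof (induction arbitrary: u rule: finite_ne_induct)
    case (singleton c)
    then show ?case using ham_cycle_singleton[of u m c] assms(4) by blast
  next
    case (insert c S)
    then obtain f where f: "ham_cycle m S f" "f 0 = u(c := undefined)"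
      using insert.IH[of "u(c := undefined)"] torus_del[of u m c S] by blast
    have "u c < m" using insert.prems by (simp add: torus_less)
    then have "staircase m c (u c) f (\<lambda>i. (i + 0) div m) 0 = u"
      using f(2) by (simp add: staircase_def)
    then show ?case
      using ham_cycle_insert[OF f(1) insert.hyps(1-3) assms(4), of "u c" 0] by blast
  qed
  then show thesis using that by blast
qed

section \<open>Choosing the position of the endpoint\<close>

text \<open>Offset 0 puts \<open>v\<close> at position \<open>q * m + s\<close>, and offset
  \<open>m - 1\<close> puts it at \<open>(q - 1) * m + s\<close>. These differ by the odd number
  \<open>m\<close>, so one of them is even. The second needs \<open>s > 0\<close>; if
  \<open>s = 0\<close>, the first is \<open>q * m\<close>, which is even for even \<open>q\<close>.
  The last hypothesis on \<open>q\<close> excludes the remaining case of odd \<open>q\<close> with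
  \<open>s = 0\<close>.\<close>

lemma even_position_insert:
  assumes f: "ham_cycle m S f" and S: "finite S" "S \<noteq> {}" "c \<notin> S" and m: "m \<ge> 2" "odd m"
    and uv: "u \<in> torus m (insert c S)" "v \<in> torus m (insert c S)"
    and ends: "f 0 = u(c := undefined)" "f q = v(c := undefined)"
    and q: "0 < q" "q < m ^ card S" "even q \<or> \<not> [q + v c = u c] (mod m)"
  shows "\<exists>g z. ham_cycle m (insert c S) g \<and> g 0 = u \<and> g z = v \<and> even z \<and>
    z < m ^ card (insert c S)"
proof -
  have lt: "u c < m" "v c < m" using uv by (simp_all add: torus_less)
  \<comment> \<open>The solution of \<open>u c + (q * m + s) + (m - 1) * q = v c\<close> modulo
    \<open>m\<close>, with \<open>m - u c\<close> standing for the negative of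
    \<open>u c\<close>.\<close>
  define s where "s = (q + v c + (m - u c)) mod m"
  have s: "s < m" using m by (simp add: s_def)
  have bound: "q * m + s < m ^ card (insert c S)"
  proof -
    have "q * m + s < Suc q * m" using s by simp
    also have "\<dots> \<le> m ^ card S * m" using q(2) by (intro mult_right_mono) auto
    finally show ?thesis using S by (simp add: mult.commute)
  qed
  have "[u c + (q * m + s) + (m - 1) * q = u c + (q * m + (q + v c + (m - u c))) + (m - 1) * q] (mod m)"
    by (intro cong_add cong_refl) (simp add: s_def)
  also have "u c + (q * m + (q + v c + (m - u c))) + (m - 1) * q = v c + m * (2 * q + 1)"
    using lt m by (cases m) (simp_all add: algebra_simps)
  finally have coord: "[u c + (q * m + s) + (m - 1) * q = v c] (mod m)"
    by (simp only: cong_def mod_mult_self2)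
  have start: "staircase m c (u c) f (\<lambda>i. (i + r) div m) 0 = u" if "r < m" for r
    using that lt ends(1) by (simp add: staircase_def)
  show ?thesis
  proof (cases "even (q + s)")
    case True
    have "staircase m c (u c) f (\<lambda>i. (i + 0) div m) (q * m + s) = v"
      using coord s lt ends(2) by (simp add: staircase_def cong_def)
    moreover have "even (q * m + s)" using True m(2) by simp
    moreover have "staircase m c (u c) f (\<lambda>i. (i + 0) div m) 0 = u"
      by (rule start) (use m in simp)
    ultimately show ?thesis
      using ham_cycle_insert[OF f S m(1), of "u c" 0] bound by blast
  next
    case False
    have "s \<noteq> 0"
    proof
      assume "s = 0"
      then have "[q + v c + (m - u c) = 0] (mod m)" by (simp add: s_def cong_def)
      then have "[q + v c + (m - u c) + u c = 0 + u c] (mod m)" by (intro cong_add) auto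
      then have "[q + v c = u c] (mod m)" using lt by (simp add: cong_def)
      then show False using q(3) False \<open>s = 0\<close> by simp
    qed
    \<comment> \<open>Starting at the last vertex of a row instead of the first saves the length m of one row,
        which is odd.\<close>
    define z where "z = (q - 1) * m + s"
    have z: "z + m = q * m + s" using q(1) by (cases q) (simp_all add: z_def)
    then have "z + (m - 1) = q * m + (s - 1)" using \<open>s \<noteq> 0\<close> m by simp
    then have div: "(z + (m - 1)) div m = q" using s by simp
    have "[u c + z + (m - 1) * q + m = v c] (mod m)"
      using coord unfolding z[symmetric] by (simp add: ac_simps)
    then have "[u c + z + (m - 1) * q = v c] (mod m)" by (simp add: cong_def)
    then have "staircase m c (u c) f (\<lambda>i. (i + (m - 1)) div m) z = v"
      using div lt ends(2) by (simp add: staircase_def cong_def)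
    moreover have "even z" using False m(2) z q(1) by (metis even_add even_mult_iff)
    moreover have "z < m ^ card (insert c S)" using bound z by simp
    moreover have "staircase m c (u c) f (\<lambda>i. (i + (m - 1)) div m) 0 = u"
      by (rule start) (use m in simp)
    ultimately show ?thesis
      using ham_cycle_insert[OF f S m(1), of "u c" "m - 1"] by blast
  qed
qed

text \<open>Induction on the number of coordinates: a smaller torus supplies an even
  \<open>q\<close>. When only two coordinates are left, at least one choice of the coordinate to
  split off meets the side condition of \<open>even_position_insert\<close>.\<close>

lemma even_position:
  assumes "m \<ge> 2" "odd m" "card S \<ge> 2" "u \<in> torus m S" "v \<in> torus m S"
  shows "\<exists>f z. ham_cycle m S f \<and> f 0 = u \<and> f z = v \<and> even z \<and> z < m ^ card S"
  using assms(3-)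
proof (induction "card S" arbitrary: S u v rule: less_induct)
  case less
  have fin: "finite S" using less.prems(1) by (intro card_ge_0_finite) simp
  show ?case
  proof (cases "u = v")
    case True
    obtain f where "ham_cycle m S f" "f 0 = u"
      using ham_cycle_exists[OF fin _ less.prems(2) assms(1)] less.prems(1) by (metis card.empty not_numeral_le_zero)
    then show ?thesis using True assms(1) by (intro exI[of _ f] exI[of _ 0]) simp
  next
    case False
    \<comment> \<open>A coordinate \<open>d\<close> that separates \<open>u\<close> from
      \<open>v\<close> is kept and a different one is split off. The projections then still differ,
      which makes the position \<open>q\<close> positive.\<close>
    then obtain d where d: "d \<in> S" "u d \<noteq> v d"
      using less.prems(2,3) unfolding torus_def by (metis PiE_ext)
    have "S - {d} \<noteq> {}" using less.prems(1) d fin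
      by (metis One_nat_def card.empty card_Suc_Diff1 not_less_eq_eq numeral_2_eq_2 order_refl)
    then obtain c where c: "c \<in> S" "c \<noteq> d" by blast
    define S' where "S' = S - {c}"
    have S': "finite S'" "S' \<noteq> {}" "c \<notin> S'" "S = insert c S'" "d \<in> S'"
      using fin c d by (auto simp: S'_def)
    have card: "card S = Suc (card S')" using S' by simp
    have uv': "u(c := undefined) \<in> torus m S'" "v(c := undefined) \<in> torus m S'"
      using less.prems(2,3) torus_del[of _ m c S'] S'(3,4) by auto
    have ne: "u(c := undefined) \<noteq> v(c := undefined)" using d c by (metis fun_upd_other)
    show ?thesis
    proof (cases "card S' \<ge> 2")
      case True
      then obtain f q where f: "ham_cycle m S' f" "f 0 = u(c := undefined)"
          "f q = v(c := undefined)" "even q" "q < m ^ card S'"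
        using less.hyps[OF _ True uv'] card by auto
      then have "q > 0" using ne by (metis gr0I)
      then show ?thesis
        using even_position_insert[of m S' f c u v q] f S' assms(1,2) less.prems by blast
    next
      case False
      then have "card S' = 1" using S' card less.prems(1) by linarith
      then have Sd: "S' = {d}" using S'(5) by (metis card_1_singletonE singletonD)
      \<comment> \<open>The displacement from \<open>u\<close> to \<open>v\<close> in direction
        \<open>a\<close>, hence the position of the target on a cycle in that single
        direction.\<close>
      define pos where "pos a = (v a + (m - u a)) mod m" for a
      have lt: "u a < m" "v a < m" if "a \<in> S" for a
        using torus_less[OF less.prems(2) that] torus_less[OF less.prems(3) that] by simp_all
      have pos0: "pos a > 0" if "a \<in> S" "u a \<noteq> v a" for a
      proof (rule ccontr)
        assume "\<not> pos a > 0"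
        then have "[v a + (m - u a) = 0] (mod m)" by (simp add: pos_def cong_def)
        then have "[v a + (m - u a) + u a = 0 + u a] (mod m)" by (intro cong_add) auto
        then show False using lt[OF that(1)] that(2) by (simp add: cong_def)
      qed
      have main: ?thesis if ab: "S = {a, b}" "a \<noteq> b" "u b \<noteq> v b"
        and q: "even (pos b) \<or> \<not> [pos b + v a = u a] (mod m)" for a b
      proof -
        have t: "u(a := undefined) \<in> torus m {b}" "v(a := undefined) \<in> torus m {b}"
          using less.prems(2,3) torus_del[of _ m a "{b}"] ab(1,2) by auto
        define f where "f i = (u(a := undefined))(b := ((u(a := undefined)) b + i) mod m)" for i
        have f: "ham_cycle m {b} f" "f 0 = u(a := undefined)"
          using ham_cycle_singleton[OF t(1) assms(1)] unfolding f_def by simp_all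
        have lt': "u b < m" "v b < m" using lt ab by auto
        have "(u b + pos b) mod m = v b"
          using lt' by (simp add: pos_def mod_simps)
        then have "f (pos b) = (u(a := undefined))(b := v b)" using ab by (simp add: f_def)
        also have "\<dots> = v(a := undefined)"
          using t ab(2) unfolding torus_def PiE_def extensional_def by fastforce
        finally show ?thesis
          using even_position_insert[of m "{b}" f a u v "pos b"] f ab pos0[of b] q
            assms(1,2) less.prems(2,3) by (simp add: pos_def)
      qed
      have S2: "S = {c, d}" "S = {d, c}" using S'(4) Sd by auto
      show ?thesis
      proof (cases "even (pos d) \<or> \<not> [pos d + v c = u c] (mod m)")
        case True
        then show ?thesis using main[of c d] S2 c d by blast
      next
        case False
        \<comment> \<open>Failure for \<open>d\<close> means that \<open>pos d\<close> is odd and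
          the two displacements cancel modulo \<open>m\<close>. Their sum lies strictly between 0
          and \<open>2 * m\<close>, so it is the odd number \<open>m\<close>; thus
          \<open>pos c\<close> is even and the roles of \<open>c\<close> and \<open>d\<close> can be
          exchanged.\<close>
        have "[pos c + pos d = v c + (m - u c) + pos d] (mod m)"
          by (intro cong_add) (auto simp: pos_def)
        also have "v c + (m - u c) + pos d = (pos d + v c) + (m - u c)" by simp
        also have "[\<dots> = u c + (m - u c)] (mod m)" using False by (intro cong_add) auto
        also have "u c + (m - u c) = m" using lt[of c] c by simp
        finally have "m dvd pos c + pos d" by (simp add: cong_def dvd_eq_mod_eq_0)
        then obtain k where k: "pos c + pos d = m * k" ..
        have pos: "pos c < m" "pos d < m" using assms(1) by (simp_all add: pos_def)
        have "pos d > 0" using False by (auto intro: Nat.gr0I)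
        then have "m * 0 < m * k" "m * k < m * 2" using k pos by linarith+
        then have "0 < k" "k < 2" by (auto simp only: mult_less_cancel1)
        then have sum: "pos c + pos d = m" using k by (simp add: less_2_cases_iff)
        then have "even (pos c)" using False assms(2) by (metis even_add)
        moreover have "u c \<noteq> v c"
        proof
          assume "u c = v c"
          then have "pos c = 0" using lt[of c] c by (simp add: pos_def)
          then show False using sum pos by simp
        qed
        ultimately show ?thesis using main[of d c] S2 c by blast
      qed
    qed
  qed
qed

section \<open>Hamiltonian paths of tori\<close>

text \<open>A staircase is injective if its positions on \<open>f\<close>, one per round of
  \<open>m\<close> steps, are distinct modulo \<open>N\<close>. The schedule below uses each residue
  once and ends at \<open>N + 2 * h\<close>, above the projection of \<open>v\<close>; the sum
  condition then fixes coordinate \<open>c\<close>.\<close>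

lemma ham_path_insert:
  assumes f: "ham_cycle m S f" and S: "finite S" "S \<noteq> {}" "c \<notin> S" and m: "m \<ge> 2"
    and uv: "u \<in> torus m (insert c S)" "v \<in> torus m (insert c S)"
    and ends: "f 0 = u(c := undefined)" "f (2 * h) = v(c := undefined)"
    and h: "2 * h < m ^ card S"
    and sum: "[Suc (sum v (insert c S)) = sum u (insert c S)] (mod m)"
  shows "\<exists>p. ham_path m (insert c S) p \<and> p 0 = u \<and> p (m ^ card (insert c S) - 1) = v"
proof -
  define N where "N = m ^ card S"
  have h: "2 * h < N" using h by (simp add: N_def)
  have N: "N > 0" using m by (simp add: N_def)
  have card: "m ^ card (insert c S) = m * N" using S by (simp add: N_def)
  \<comment> \<open>In each round of m steps, from one diagonal sum = 0 to the next, \<open>f\<close> is followed on the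
      first step, and also on the last step if the position reached is less than 2h modulo N.
      The positions at the ends of the rounds are
      1, 3, ..., 2h - 1, then 2h + 1, 2h + 2, ..., N, then N + 2, N + 4, ..., N + 2h.\<close>
  define T where "T r = (if r < h then 2 * r + 1 else if r < N - h then r + h + 1
    else 2 * r + 2 * h + 2 - N)" for r
  define e where "e i = T (i div m) - (if m dvd i then 1 else 0)" for i
  define p where "p = staircase m c (u c) f e"
  have T1: "T r \<ge> 1" for r using h by (auto simp: T_def)
  \<comment> \<open>At multiples of \<open>m\<close>, \<open>e\<close> is one below
    \<open>T\<close>. So an increment of \<open>T\<close> by 1 or 2 means that the last step of the
    round leaves \<open>e\<close> fixed or advances it.\<close>
  have T_Suc: "T (Suc r) = T r + 1 \<or> T (Suc r) = T r + 2" for r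
    using h by (auto simp: T_def)
  \<comment> \<open>Modulo \<open>N\<close> the three ranges of \<open>T\<close> yield the odd
    numbers below \<open>2 * h\<close>, the numbers from \<open>2 * h + 1\<close> to
    \<open>N\<close>, and the even numbers from 2 to \<open>2 * h\<close>.\<close>
  have T_inj: "r = s" if cong: "[T r = T s] (mod N)" and lt: "r < N" "s < N" for r s
  proof -
    have *: "r = s" if "T s = T r + N * x" "r < N" "s < N" for r s x
    proof -
      have "T s \<le> N + 2 * h" using \<open>s < N\<close> h by (auto simp: T_def)
      moreover have "T r \<ge> 1" by (rule T1)
      ultimately have "N * x < N * 2" using that(1) h by linarith
      then consider "x = 0" | "x = 1" by fastforce
      then show ?thesis
      proof cases
        case 1
        then have "T s = T r" using that by simp
        then show ?thesis using h that(2,3) by (auto simp: T_def split: if_splits; presburger)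
      next
        case 2
        \<comment> \<open>Here \<open>T r\<close> would lie in the first range, hence be odd, and
          \<open>T s\<close> in the third, where \<open>T s + N\<close> is even; but
          \<open>T s + N = T r + 2 * N\<close>.\<close>
        then have *: "T s = T r + N" using that by simp
        have "T s \<le> N + 2 * h" using \<open>s < N\<close> h by (auto simp: T_def)
        then have "T r \<le> 2 * h" using * by simp
        then have "r < h" by (auto simp: T_def split: if_splits)
        then have "odd (T r)" by (simp add: T_def)
        have "T s > N" using * T1[of r] by simp
        then have "s \<ge> N - h" using h by (auto simp: T_def split: if_splits)
        then have "\<not> s < h" "\<not> s < N - h" "N \<le> 2 * s + 2 * h + 2" using h by linarith+
        then have "T s + N = 2 * s + 2 * h + 2" by (simp add: T_def)
        then have "T r + 2 * N = 2 * (s + h + 1)" using * by simp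
        then show ?thesis using \<open>odd (T r)\<close> by (metis dvd_triv_left even_add)
      qed
    qed
    show ?thesis
    proof (cases "T r \<le> T s")
      case True
      then obtain x where "T s = x * N + T r"
        using cong_le_nat[OF True] cong_sym[OF cong] by blast
      then show ?thesis using *[of s r x] lt by (simp add: ac_simps)
    next
      case False
      then have "T s \<le> T r" by simp
      then obtain x where "T r = x * N + T s"
        using cong_le_nat cong by blast
      then show ?thesis using *[of r s x] lt by (simp add: ac_simps)
    qed
  qed
  have e_Suc: "e (Suc i) = e i \<or> e (Suc i) = Suc (e i)" for i
  proof (cases "m dvd Suc i")
    case True
    then have "\<not> m dvd i" using m by (metis dvd_add_right_iff nat_dvd_1_iff_1 plus_1_eq_Suc
      add.commute not_numeral_le_zero numeral_le_one_iff semiring_norm(69))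
    then show ?thesis using True T_Suc[of "i div m"]
      by (auto simp: e_def div_Suc dvd_eq_mod_eq_0)
  next
    case False
    then have "Suc i div m = i div m" by (simp add: div_Suc dvd_eq_mod_eq_0)
    then show ?thesis using False T1[of "i div m"] by (auto simp: e_def)
  qed
  have step: "step m (insert c S) (p i) (p (Suc i))" for i
    unfolding p_def using step_staircase[OF f S(3) m] e_Suc by blast
  have "i = j" if "p i = p j" "i < m * N" "j < m * N" for i j
  proof -
    have eq: "[e i = e j] (mod N)" "[i = j] (mod m)"
      using that(1) staircase_eq_iff[OF f S m] by (simp_all add: p_def N_def)
    \<comment> \<open>Congruent indices get the same correction in \<open>e\<close>, so the
      congruence passes to \<open>T\<close>.\<close>
    have "m dvd i \<longleftrightarrow> m dvd j" using eq(2) by (simp add: cong_dvd_iff)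
    moreover have "e l + (if m dvd l then 1 else 0) = T (l div m)" for l
      using T1 by (simp add: e_def)
    ultimately have "[T (i div m) = T (j div m)] (mod N)"
      using eq(1) by (metis cong_add_rcancel_nat)
    moreover have "i div m < N" "j div m < N"
      using that(2,3) by (simp_all add: less_mult_imp_div_less mult.commute)
    ultimately have "i div m = j div m" using T_inj by blast
    then show "i = j" using eq(2) by (metis cong_def div_mult_mod_eq)
  qed
  then have "ham_path m (insert c S) p"
    using step staircase_in_torus[OF f m] by (auto simp: ham_path_def card inj_on_def p_def)
  moreover have "p 0 = u"
  proof -
    have "e 0 = 0" using h by (simp add: e_def T_def)
    then show ?thesis using uv(1) ends(1) by (simp add: p_def staircase_def torus_less)
  qed
  moreover have "p (m * N - 1) = v"
  proof -
    have m1: "m * N - 1 = (N - 1) * m + (m - 1)"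
      using N m by (cases N) (simp_all add: algebra_simps)
    have "(m * N - 1) div m = N - 1" "(m * N - 1) mod m = m - 1"
    proof -
      have "(x * m + d) div m = x" "(x * m + d) mod m = d" if "d < m" for x d
        using that by simp_all
      moreover have "m - 1 < m" using m by simp
      ultimately show "(m * N - 1) div m = N - 1" "(m * N - 1) mod m = m - 1"
        unfolding m1 by blast+
    qed
    \<comment> \<open>The last index is not a multiple of \<open>m\<close>, so no correction
      applies; the position lies one full turn beyond \<open>2 * h\<close>.\<close>
    then have "e (m * N - 1) = T (N - 1)" using m by (simp add: e_def dvd_eq_mod_eq_0)
    also have "\<dots> = 2 * h + N" using h by (auto simp: T_def)
    finally have "[e (m * N - 1) = 2 * h] (mod N)" by (simp add: cong_def)
    then have "f (e (m * N - 1)) = v(c := undefined)"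
      using f unfolding ends(2)[symmetric] ham_cycle_def N_def by blast
    then obtain y where y: "p (m * N - 1) = v(c := y)"
      by (simp add: p_def staircase_def)
    have "p (m * N - 1) \<in> torus m (insert c S)"
      using staircase_in_torus[OF f m] by (simp add: p_def)
    then have ym: "y < m" using torus_less[of "v(c := y)" m _ c] y by simp
    have sum_y: "sum (v(c := y)) (insert c S) + v c = sum v (insert c S) + y"
    proof -
      have "sum (v(c := y)) S = sum v S" using S by (intro sum.cong) auto
      then show ?thesis using S by simp
    qed
    \<comment> \<open>The walk has length \<open>m * N - 1\<close>, which is -1 modulo
      \<open>m\<close>. Comparing coordinate sums with the hypothesis on \<open>u\<close> and
      \<open>v\<close> forces \<open>y = v c\<close>.\<close>
    have "[sum (v(c := y)) (insert c S) = sum u (insert c S) + (m * N - 1)] (mod m)"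
      using sum_walk[of "m * N - 1" m "insert c S" p] step S y \<open>p 0 = u\<close> by simp
    then have "[sum (v(c := y)) (insert c S) + (v c + 1) =
        sum u (insert c S) + (m * N - 1) + (v c + 1)] (mod m)"
      by (intro cong_add cong_refl)
    moreover have "sum u (insert c S) + (m * N - 1) + (v c + 1) = sum u (insert c S) + v c + m * N"
      using N m by (simp add: Suc_le_eq)
    moreover have "sum (v(c := y)) (insert c S) + (v c + 1) = Suc (sum v (insert c S)) + y"
      using sum_y by simp
    ultimately have "[Suc (sum v (insert c S)) + y = sum u (insert c S) + v c + m * N] (mod m)"
      by (simp only:)
    then have "[Suc (sum v (insert c S)) + y = sum u (insert c S) + v c] (mod m)"
      by (simp add: cong_def)
    moreover have "[Suc (sum v (insert c S)) + y = sum u (insert c S) + y] (mod m)"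
      using sum by (intro cong_add cong_refl)
    ultimately have "[sum u (insert c S) + y = sum u (insert c S) + v c] (mod m)"
      using cong_sym cong_trans by blast
    then have "[y = v c] (mod m)" by (simp add: cong_add_lcancel_nat)
    then have "y = v c" using ym uv(2) torus_less[of v m _ c] by (simp add: cong_def)
    then show ?thesis using y by simp
  qed
  ultimately show ?thesis using card by auto
qed

lemma ham_path_exists:
  assumes S: "finite S" "card S \<ge> 3" and m: "m \<ge> 2" and uv: "u \<in> torus m S" "v \<in> torus m S"
    and sum: "[Suc (sum v S) = sum u S] (mod m)"
  shows "\<exists>p. ham_path m S p \<and> p 0 = u \<and> p (m ^ card S - 1) = v"
proof -
  have "\<exists>c\<in>S. \<exists>f z. ham_cycle m (S - {c}) f \<and> f 0 = u(c := undefined) \<and> f z = v(c := undefined) \<and>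
      even z \<and> z < m ^ card (S - {c})"
  proof (cases "even m")
    case True
    \<comment> \<open>For even \<open>m\<close> the congruence determines parities: the two sums
      differ in parity, so some coordinate does too.\<close>
    then have *: "even (Suc (sum v S)) = even (sum u S)"
      using sum cong_dvd_modulus_nat cong_dvd_iff by blast
    have "\<exists>c\<in>S. even (u c) \<noteq> even (v c)"
    proof (rule ccontr)
      assume "\<not> ?thesis"
      then have "even (sum u S) = even (sum v S)" using S(1)
        by (simp add: even_sum_iff) (metis (mono_tags, lifting) Collect_cong)
      then show False using * by simp
    qed
    then obtain c where c: "c \<in> S" "even (u c) \<noteq> even (v c)" by blast
    define S' where "S' = S - {c}"
    have S': "finite S'" "S' \<noteq> {}" "c \<notin> S'" "S = insert c S'"
    proof -
      have "card S' \<noteq> 0" using S c by (simp add: S'_def)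
      then show "S' \<noteq> {}" by auto
    qed (use S c in \<open>auto simp: S'_def\<close>)
    have t: "u(c := undefined) \<in> torus m S'" "v(c := undefined) \<in> torus m S'"
      using uv torus_del[of _ m c S'] S'(3,4) by auto
    obtain f where f: "ham_cycle m S' f" "f 0 = u(c := undefined)"
      using ham_cycle_exists[OF S'(1,2) t(1) m] by blast
    obtain z where z: "z < m ^ card S'" "f z = v(c := undefined)"
      using ham_cycle_surj[OF f(1) S'(1) t(2)] by blast
    \<comment> \<open>The parity of \<open>z\<close> is that of the change in the sum over
      \<open>S'\<close>: an odd total change less the odd change in \<open>c\<close>.\<close>
    have "[sum (f z) S' = sum (f 0) S' + z] (mod m)"
      using sum_walk[of z m S' f] f(1) S'(1) by (simp add: ham_cycle_def)
    moreover have "sum (f z) S' = sum v S'" "sum (f 0) S' = sum u S'"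
      using S'(3) z(2) f(2) by (auto intro!: sum.cong)
    ultimately have "even (sum v S') = even (sum u S' + z)"
      using True cong_dvd_modulus_nat cong_dvd_iff by metis
    moreover have "sum v S = v c + sum v S'" "sum u S = u c + sum u S'" using S' by simp_all
    ultimately have "even z" using * c(2) by auto
    then show ?thesis using c(1) f z by (auto simp: S'_def)
  next
    case False
    obtain c where c: "c \<in> S" using S by force
    then have S': "S = insert c (S - {c})" "card (S - {c}) \<ge> 2" using S by auto
    then have t: "u(c := undefined) \<in> torus m (S - {c})" "v(c := undefined) \<in> torus m (S - {c})"
      using uv torus_del[of _ m c "S - {c}"] by auto
    \<comment> \<open>Any \<open>c\<close> will do: at least two coordinates remain, as
      \<open>even_position\<close> requires.\<close>
    show ?thesis using even_position[OF m False S'(2) t] c by blast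
  qed
  then obtain c f z where c: "c \<in> S" and f: "ham_cycle m (S - {c}) f" "f 0 = u(c := undefined)"
      "f z = v(c := undefined)" "even z" "z < m ^ card (S - {c})"
    by blast
  have S': "insert c (S - {c}) = S" "finite (S - {c})" "c \<notin> S - {c}" using c S by auto
  have "card (S - {c}) \<noteq> 0" using S c by simp
  then have ne: "S - {c} \<noteq> {}" by (metis card.empty)
  obtain h where "z = 2 * h" using f(4) by (elim evenE)
  then show ?thesis
    using ham_path_insert[OF f(1) S'(2) ne S'(3) m, of u v h] uv sum f S'(1) by simp
qed

section \<open>Cartesian powers of directed cycles\<close>

text \<open>The restriction makes the list an extensional function, so that \<open>coords\<close>
  and \<open>\<lambda>g. map g [0..<k]\<close> are mutually inverse between vertices of the power
  and \<open>torus m {..<k}\<close>.\<close>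

definition coords :: "nat list \<Rightarrow> nat \<Rightarrow> nat" where
  "coords xs = restrict ((!) xs) {..<length xs}"

lemma map_coords: "map (coords xs) [0..<length xs] = xs"
  by (rule nth_equalityI) (simp_all add: coords_def)

lemma coords_map:
  assumes "g \<in> torus m {..<k}"
  shows "coords (map g [0..<k]) = g"
  using assms by (auto simp: coords_def torus_def PiE_def extensional_def fun_eq_iff)

lemma pverts_cycle_power:
  "pverts (cartesian_power k (directed_cycle m)) = {xs. set xs \<subseteq> {0..<m} \<and> length xs = k}"
  by (auto simp: pverts_cartesian_power directed_cycle_def)

lemma card_pverts_cycle_power: "card (pverts (cartesian_power k (directed_cycle m))) = m ^ k"
  by (simp add: pverts_cycle_power card_lists_length_eq)

lemma nth_less:
  assumes "set xs \<subseteq> {0..<m}" "i < length xs"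
  shows "xs ! i < m"
proof -
  have "xs ! i \<in> {0..<m}" using assms(1) nth_mem[OF assms(2)] by (rule subsetD)
  then show ?thesis by simp
qed

lemma coords_in_torus:
  assumes "xs \<in> pverts (cartesian_power k (directed_cycle m))"
  shows "coords xs \<in> torus m {..<k}"
proof -
  have "xs ! i < m" if "i < k" for i
    using assms that by (intro nth_less) (auto simp: pverts_cycle_power)
  then show ?thesis using assms by (auto simp: coords_def torus_def pverts_cycle_power)
qed

lemma map_in_pverts:
  "g \<in> torus m {..<k} \<Longrightarrow> map g [0..<k] \<in> pverts (cartesian_power k (directed_cycle m))"
  using torus_less by (fastforce simp: pverts_cycle_power)

lemma pair_wf_directed_cycle: "pair_wf_digraph (directed_cycle m)"
  by unfold_locales (auto simp: directed_cycle_def)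

lemma parcs_cycle_power:
  "(xs, ys) \<in> parcs (cartesian_power k (directed_cycle m)) \<longleftrightarrow>
    xs \<in> pverts (cartesian_power k (directed_cycle m)) \<and> (\<exists>i<k. ys = xs[i := Suc (xs ! i) mod m])"
proof -
  have "(x, y) \<in> parcs (directed_cycle m) \<longleftrightarrow> x < m \<and> y = Suc x mod m" for x y
    by (auto simp: directed_cycle_def)
  moreover have "pverts (directed_cycle m) = {0..<m}"
    by (simp add: directed_cycle_def)
  ultimately show ?thesis
    unfolding parcs_cartesian_power[OF pair_wf_directed_cycle] pverts_cycle_power
    using nth_less[of xs m] by (simp only: mem_Collect_eq) blast
qed

lemma step_coords:
  assumes "(xs, ys) \<in> parcs (cartesian_power k (directed_cycle m))"
  shows "step m {..<k} (coords xs) (coords ys)"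
proof -
  obtain i where i: "i < k" "length xs = k" "ys = xs[i := Suc (xs ! i) mod m]"
    using assms by (auto simp: parcs_cycle_power pverts_cycle_power)
  then have "coords ys = (coords xs)(i := Suc (coords xs i) mod m)"
    by (auto simp: coords_def fun_eq_iff nth_list_update)
  then show ?thesis using i(1) by (auto simp: step_def)
qed

lemma arc_map:
  assumes "step m {..<k} g h" "g \<in> torus m {..<k}"
  shows "(map g [0..<k], map h [0..<k]) \<in> parcs (cartesian_power k (directed_cycle m))"
proof -
  obtain i where i: "i < k" "h = g(i := Suc (g i) mod m)"
    using assms(1) by (auto simp: step_def)
  then have "map h [0..<k] = (map g [0..<k])[i := Suc (map g [0..<k] ! i) mod m]"
    by (intro nth_equalityI) (auto simp: nth_list_update)
  then show ?thesis using i(1) map_in_pverts[OF assms(2)] by (auto simp: parcs_cycle_power)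
qed

section \<open>Transfer between walks in the power and sequences on the torus\<close>

lemma sum_vwalk:
  assumes "vwalk p (with_proj (cartesian_power k (directed_cycle m)))"
  shows "[sum (coords (last p)) {..<k} = sum (coords (hd p)) {..<k} + vwalk_length p] (mod m)"
  using assms
proof (induction rule: vwalk_induct)
  case (Cons x y es)
  have "[sum (coords y) {..<k} = Suc (sum (coords x) {..<k})] (mod m)"
    using sum_step[OF step_coords] Cons(1) by simp
  then have "[sum (coords y) {..<k} + length es = Suc (sum (coords x) {..<k}) + length es] (mod m)"
    by (intro cong_add cong_refl)
  then show ?case using Cons(2) cong_trans by fastforce
qed simp

lemma vwalk_arcs_nth:
  "a \<in> set (vwalk_arcs p) \<Longrightarrow> \<exists>i. Suc i < length p \<and> a = (p ! i, p ! Suc i)"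
proof (induction p rule: vwalk_arcs.induct)
  case (3 x y xs)
  show ?case
  proof (cases "a = (x, y)")
    case True
    then show ?thesis by (intro exI[of _ 0]) simp
  next
    case False
    then obtain i where "Suc i < length (y # xs)" "a = ((y # xs) ! i, (y # xs) ! Suc i)"
      using 3 by auto
    then show ?thesis by (intro exI[of _ "Suc i"]) simp
  qed
qed simp_all

lemma vpath_map:
  assumes torus: "\<And>i. i \<le> n \<Longrightarrow> f i \<in> torus m {..<k}"
    and step: "\<And>i. i < n \<Longrightarrow> step m {..<k} (f i) (f (Suc i))"
    and inj: "inj_on f {..n}"
  shows "vpath (map (\<lambda>i. map (f i) [0..<k]) [0..<Suc n]) (with_proj (cartesian_power k (directed_cycle m)))"
proof (intro vpathI vwalkI)
  let ?p = "map (\<lambda>i. map (f i) [0..<k]) [0..<Suc n]"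
  show "set ?p \<subseteq> verts (with_proj (cartesian_power k (directed_cycle m)))"
    using map_in_pverts[OF torus] by (auto simp del: upt_Suc)
  show "?p \<noteq> []" by simp
  show "set (vwalk_arcs ?p) \<subseteq> arcs_ends (with_proj (cartesian_power k (directed_cycle m)))"
  proof
    fix a assume "a \<in> set (vwalk_arcs ?p)"
    then obtain i where i: "Suc i < length ?p" "a = (?p ! i, ?p ! Suc i)"
      using vwalk_arcs_nth by blast
    then have "i < n" by simp
    then have "a = (map (f i) [0..<k], map (f (Suc i)) [0..<k])"
      unfolding i(2) by (simp del: upt_Suc)
    then show "a \<in> arcs_ends (with_proj (cartesian_power k (directed_cycle m)))"
      using arc_map[OF step torus] \<open>i < n\<close> by simp
  qed
  have "inj_on (\<lambda>i. map (f i) [0..<k]) {..n}"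
  proof (rule inj_onI)
    fix i j assume ij: "i \<in> {..n}" "j \<in> {..n}" "map (f i) [0..<k] = map (f j) [0..<k]"
    then have "f i = f j" using coords_map[OF torus] by (metis atMost_iff)
    then show "i = j" using inj ij by (simp add: inj_on_def)
  qed
  then show "distinct ?p"
    by (simp add: distinct_map atLeast0LessThan lessThan_Suc_atMost del: upt_Suc)
qed

theorem theorem3p2:
  fixes k m :: nat
    and X :: "(nat list, nat list \<times> nat list) pre_digraph"
    and u v :: "nat list"
  assumes "k \<ge> 3" and "m \<ge> 2"
    and "X = with_proj (cartesian_power k (directed_cycle m))"
    and "u \<in> verts X" and "v \<in> verts X"
  shows "(\<exists>p. hamiltonian_path X u p v) \<longleftrightarrow> [int (digraph_dist X u v) = -1] (mod int m)"
proof -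
  define s where "s xs = sum (coords xs) {..<k}" for xs
  have uv: "coords u \<in> torus m {..<k}" "coords v \<in> torus m {..<k}"
    using assms(3-5) coords_in_torus by simp_all
  have len: "length u = k" "length v = k"
    using assms(3-5) by (simp_all add: pverts_cycle_power)
  have sum_path: "[s v = s u + vwalk_length p] (mod m)" if "vpath p X" "hd p = u" "last p = v" for p
    using sum_vwalk[of p k m] that assms(3) by (auto simp: s_def vpath_def)
  \<comment> \<open>An initial segment of a hamiltonian cycle through \<open>u\<close> joins
    \<open>u\<close> to \<open>v\<close>, so the minimum defining the distance is attained.\<close>
  have "\<exists>n p. vpath p X \<and> hd p = u \<and> last p = v \<and> vwalk_length p = n"
  proof -
    have ne: "{..<k} \<noteq> {}" using assms(1) by (simp add: lessThan_empty_iff)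
    obtain f where f: "ham_cycle m {..<k} f" "f 0 = coords u"
      by (rule ham_cycle_exists[OF finite_lessThan ne uv(1) assms(2)])
    obtain z where "z < m ^ card {..<k}" and z: "f z = coords v"
      by (rule ham_cycle_surj[OF f(1) finite_lessThan uv(2)])
    then have zk: "z < m ^ k" by simp
    have "inj_on f {..z}"
      using f(1) zk by (auto simp: ham_cycle_def inj_on_def cong_def)
    then have "vpath (map (\<lambda>i. map (f i) [0..<k]) [0..<Suc z]) X"
      using vpath_map[of z f m k] f(1) assms(3) by (auto simp: ham_cycle_def)
    moreover have "map (f 0) [0..<k] = u" "map (f z) [0..<k] = v"
      using f(2) z map_coords len by metis+
    ultimately show ?thesis
      by (intro exI conjI) (auto simp: hd_map last_map simp del: upt_Suc)
  qed
  then have "\<exists>p. vpath p X \<and> hd p = u \<and> last p = v \<and> vwalk_length p = digraph_dist X u v"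
    unfolding digraph_dist_def by (rule LeastI_ex)
  then obtain p where p: "vpath p X" "hd p = u" "last p = v" "vwalk_length p = digraph_dist X u v"
    by (elim exE conjE)
  have dist: "[s v = s u + digraph_dist X u v] (mod m)"
    using sum_path[OF p(1-3)] unfolding p(4) .
  \<comment> \<open>Since the distance is the length of an actual path, the condition on it becomes
    one on the coordinate sums alone.\<close>
  have "[int (digraph_dist X u v) = -1] (mod int m) \<longleftrightarrow>
      [int (digraph_dist X u v) + 1 = -1 + 1] (mod int m)"
    by (simp only: cong_add_rcancel)
  also have "\<dots> \<longleftrightarrow> [Suc (digraph_dist X u v) = 0] (mod m)"
    by (simp add: cong_iff_dvd_diff cong_0_iff flip: int_dvd_int_iff) (simp add: ac_simps)
  also have "\<dots> \<longleftrightarrow> [s u + Suc (digraph_dist X u v) = s u + 0] (mod m)"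
    by (simp only: cong_add_lcancel_nat)
  also have "\<dots> \<longleftrightarrow> [Suc (s v) = s u] (mod m)"
  proof -
    have "[s v + 1 = s u + digraph_dist X u v + 1] (mod m)"
      using dist by (intro cong_add cong_refl)
    then show ?thesis by (simp add: cong_def)
  qed
  also have "\<dots> \<longleftrightarrow> (\<exists>p. hamiltonian_path X u p v)"
  proof
    assume "[Suc (s v) = s u] (mod m)"
    then obtain f where f: "ham_path m {..<k} f" "f 0 = coords u" "f (m ^ k - 1) = coords v"
      using ham_path_exists[of "{..<k}" m "coords u" "coords v"] uv assms(1,2)
      by (auto simp: s_def)
    define n where "n = m ^ k - 1"
    have n: "m ^ k = Suc n" using assms(2) by (simp add: n_def)
    define p where "p = map (\<lambda>i. map (f i) [0..<k]) [0..<Suc n]"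
    have "{..n} = {..<m ^ k}" using n by auto
    then have p: "vpath p X"
      using vpath_map[of n f m k] f(1) n assms(3) by (simp add: ham_path_def p_def del: upt_Suc)
    have "map (f 0) [0..<k] = u" "map (f n) [0..<k] = v"
      using f(2,3) map_coords len n_def by metis+
    then have ends: "hd p = u" "last p = v"
      by (simp_all add: p_def hd_map last_map del: upt_Suc)
    \<comment> \<open>A path with as many vertices as \<open>X\<close> visits all of them.\<close>
    have "length p = Suc n" by (simp add: p_def)
    then have "card (set p) = m ^ k"
      using p n distinct_card[of p] by (simp add: vpath_def)
    moreover have "finite (verts X)"
      using card_pverts_cycle_power[of k m] assms(2,3) by (intro card_ge_0_finite) simp
    ultimately have "set p = verts X"
      using p card_pverts_cycle_power[of k m] assms(3)
      by (intro card_subset_eq) (auto simp: vpath_def vwalk_def)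
    then show "\<exists>p. hamiltonian_path X u p v"
      using p ends by (auto simp: hamiltonian_path_def)
  next
    assume "\<exists>p. hamiltonian_path X u p v"
    then obtain p where p: "vpath p X" "hd p = u" "last p = v" "set p = verts X"
      by (auto simp: hamiltonian_path_def)
    have "length p = m ^ k"
      using p(1,4) card_pverts_cycle_power[of k m] assms(3)
      by (simp add: vpath_def distinct_card[symmetric])
    moreover have "m ^ k > 0" using assms(2) by simp
    ultimately have len: "Suc (vwalk_length p) = m ^ k" by simp
    \<comment> \<open>The length plus 1 is \<open>m ^ k\<close>, which vanishes modulo
      \<open>m\<close> because \<open>k > 0\<close>.\<close>
    have "[s v + 1 = s u + vwalk_length p + 1] (mod m)"
      using sum_path[OF p(1-3)] by (intro cong_add cong_refl)
    also have "s u + vwalk_length p + 1 = s u + m ^ k" using len by simp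
    also have "[s u + m ^ k = s u + 0] (mod m)"
      using assms(1) by (intro cong_add cong_refl) (simp add: cong_0_iff dvd_power)
    finally show "[Suc (s v) = s u] (mod m)" by simp
  qed
  finally show ?thesis by simp
qed

end
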